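(* There are constants $c>0$ and $n_0$ such that for every integer $n\ge n_0$ there is an arrangement $\mathcal{A}$ of line segments whose set of endpoints has exactly $n$ points, such that for every integer $M$ with $1\leq M\leq n^4$ there is a set of at most $M$ faces of $\mathcal{A}$ with complexity at least $c\cdot\min\{nM,\,n^{4/3}M^{2/3}\}$.
   Context: An arrangement $\mathcal{A}$ of line segments is a finite collection of line segments in the plane. A vertex of $\mathcal{A}$ is a common point of two or more segments; removing the vertices from the segments yields subsegments called edges; cells are the connected components of the complement of the union of the segments; a face is the closure of a cell. A segment $s$ of $\mathcal{A}$ is incident to a face $F$ if $s$ and $F$ share an edge of $\mathcal{A}$. The complexity of a face $F$ is the number of segments of $\mathcal{A}$ incident to $F$, and the complexity of a set $\mathcal{F}$ of faces is the sum of the complexities of its members. *)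

theory Defs
  imports "HOL-Analysis.Analysis"
begin

type_synonym point = "real \<times> real"

(* Segments are nondegenerate and are identified with their point sets. *)
definition segment_arrangement :: "point set set \<Rightarrow> bool" where
  "segment_arrangement A \<longleftrightarrow>
     finite A \<and> (\<forall>s\<in>A. \<exists>p q. p \<noteq> q \<and> s = closed_segment p q)"

definition endpoints :: "point set set \<Rightarrow> point set" where
  "endpoints A = {p. \<exists>q. q \<noteq> p \<and> closed_segment p q \<in> A}"

(* If two segments overlap along a subsegment, every point of the overlap is a vertex. *)
definition vertices :: "point set set \<Rightarrow> point set" where
  "vertices A = {p. \<exists>s\<in>A. \<exists>t\<in>A. s \<noteq> t \<and> p \<in> s \<and> p \<in> t}"

definition edges :: "point set set \<Rightarrow> point set set" where
  "edges A = (\<Union>s\<in>A. components (s - vertices A))"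

definition cells :: "point set set \<Rightarrow> point set set" where
  "cells A = components (- \<Union>A)"

definition faces :: "point set set \<Rightarrow> point set set" where
  "faces A = closure ` cells A"

definition incident :: "point set set \<Rightarrow> point set \<Rightarrow> point set \<Rightarrow> bool" where
  "incident A s F \<longleftrightarrow> (\<exists>e\<in>edges A. e \<subseteq> s \<and> e \<subseteq> F)"

definition face_complexity :: "point set set \<Rightarrow> point set \<Rightarrow> nat" where
  "face_complexity A F = card {s\<in>A. incident A s F}"

definition complexity :: "point set set \<Rightarrow> point set set \<Rightarrow> nat" where
  "complexity A \<F> = (\<Sum>F\<in>\<F>. face_complexity A F)"

end

theory Submission
  imports Defs
begin

text \<open>Join each point \<open>(i, 0)\<close> with \<open>i < k\<close> to each point \<open>(j, 1)\<close> with \<open>j < l\<close>. The point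
  \<open>(s / (a + b), a / (a + b))\<close> lies on the joins with \<open>i b + j a = s\<close>, and for coprime
  \<open>a, b \<le> t\<close> these are about \<open>t\<^sup>3 k\<close> points with \<open>t\<^sup>2 k\<^sup>2\<close> incidences, as in the lower bound of
  Szemeredi and Trotter. Points are turned into faces by replacing \<open>(i, 0)\<close> with the two points
  \<open>(i \<plusminus> w, 0)\<close>, where \<open>w\<close> is tiny and strictly convex in \<open>i\<close>: each join becomes a thin triangle,
  the triangles through a common point intersect in a single cell around it, and by convexity of
  \<open>w\<close> every one of them contributes an edge to that cell.\<close>

section \<open>Segments between two horizontal lines\<close>

lemma closed_segment_to_height_one:
  fixes p :: point
  shows "p \<in> closed_segment (u, 0) (v, 1) \<longleftrightarrow>
    0 \<le> snd p \<and> snd p \<le> 1 \<and> fst p = u * (1 - snd p) + v * snd p"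
proof (cases p)
  case (Pair x y)
  then show ?thesis
    by (auto simp: in_segment algebra_simps)
qed

lemma closed_segment_height_zero:
  fixes p :: point
  assumes "u \<le> v"
  shows "p \<in> closed_segment (u, 0) (v, 0) \<longleftrightarrow> snd p = 0 \<and> u \<le> fst p \<and> fst p \<le> v"
proof -
  have "p \<in> closed_segment (u, 0) (v, 0) \<longleftrightarrow> snd p = 0 \<and> fst p \<in> closed_segment u v"
    by (cases p) (auto simp: in_segment)
  then show ?thesis
    using assms by (simp add: closed_segment_eq_real_ivl)
qed

section \<open>Density of coprime pairs\<close>

text \<open>Telescoping against \<open>1 / (t * (t + 1))\<close>, with equality at
  \<open>t = 2\<close>. The limit \<open>3 / 4\<close> leaves a quarter of all pairs for the coprime
  ones.\<close>

lemma sum_inverse_squares_le: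
  assumes "2 \<le> t"
  shows "(\<Sum>d=2..t. 1 / real d ^ 2) \<le> 3 / 4 - 1 / real t"
  using assms
proof (induction t rule: dec_induct)
  case base
  then show ?case
    by simp
next
  case (step t)
  have "1 / real (Suc t) ^ 2 \<le> 1 / (real t * real (Suc t))"
    using step(1) by (intro divide_left_mono) (auto simp: power2_eq_square)
  also have "\<dots> = 1 / real t - 1 / real (Suc t)"
    using step(1) by (simp add: field_simps)
  finally have "1 / real (Suc t) ^ 2 \<le> 1 / real t - 1 / real (Suc t)" .
  then show ?case
    using step by simp
qed

text \<open>A pair with gcd \<open>d > 1\<close> is \<open>d\<close> times a pair from a square of
  side \<open>t div d\<close>. A union bound over \<open>d\<close> leaves at most three quarters of
  all pairs non-coprime.\<close>

lemma card_coprime_pairs_ge: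
  fixes t :: nat
  defines "P \<equiv> {(a, b) \<in> {1..t} \<times> {1..t}. coprime a b}"
  shows "t ^ 2 \<le> 4 * card P"
proof (cases "2 \<le> t")
  case False
  then have "t = 0 \<or> t = 1"
    by auto
  moreover have "P = {(1, 1)}" if "t = 1"
    using that by (auto simp: P_def)
  ultimately show ?thesis
    by auto
next
  case True
  define N where "N d = (\<lambda>(a, b). (d * a, d * b)) ` ({1..t div d} \<times> {1..t div d})" for d
  have "{1..t} \<times> {1..t} \<subseteq> P \<union> (\<Union>d\<in>{2..t}. N d)"
  proof
    fix x assume x: "x \<in> {1..t} \<times> {1..t}"
    obtain a b where ab: "x = (a, b)"
      by fastforce
    define d where "d = gcd a b"
    show "x \<in> P \<union> (\<Union>d\<in>{2..t}. N d)"
    proof (cases "coprime a b")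
      case True
      then show ?thesis
        using x ab by (simp add: P_def)
    next
      case False
      have "0 < d" "d dvd a" "d dvd b"
        using x ab by (auto simp: d_def)
      moreover have "d \<noteq> 1"
        using False by (simp add: d_def coprime_iff_gcd_eq_1)
      moreover have "d \<le> a"
        using x ab by (simp add: d_def)
      ultimately have "d \<in> {2..t}"
        using x ab by auto
      moreover obtain a' b' where *: "a = d * a'" "b = d * b'"
        using \<open>d dvd a\<close> \<open>d dvd b\<close> by (elim dvdE)
      moreover have "a' \<in> {1..t div d}" "b' \<in> {1..t div d}"
        using x ab \<open>0 < d\<close> * by (auto simp: less_eq_div_iff_mult_less_eq mult.commute Suc_le_eq)
      ultimately show ?thesis
        unfolding ab N_def by force
    qed
  qed
  moreover have "finite P"
    by (rule finite_subset[of _ "{1..t} \<times> {1..t}"]) (auto simp: P_def)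
  ultimately have "card ({1..t} \<times> {1..t}) \<le> card (P \<union> (\<Union>d\<in>{2..t}. N d))"
    by (intro card_mono) (auto simp: N_def)
  also have "\<dots> \<le> card P + card (\<Union>d\<in>{2..t}. N d)"
    by (rule card_Un_le)
  also have "card (\<Union>d\<in>{2..t}. N d) \<le> (\<Sum>d=2..t. card (N d))"
    by (rule card_UN_le) simp
  also have "(\<Sum>d=2..t. card (N d)) \<le> (\<Sum>d=2..t. (t div d) ^ 2)"
  proof (rule sum_mono)
    fix d
    have "card (N d) \<le> card ({1..t div d} \<times> {1..t div d})"
      unfolding N_def by (intro card_image_le) auto
    then show "card (N d) \<le> (t div d) ^ 2"
      by (simp add: card_cartesian_product power2_eq_square)
  qed
  finally have "t ^ 2 \<le> card P + (\<Sum>d=2..t. (t div d) ^ 2)"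
    by (simp add: card_cartesian_product power2_eq_square)
  then have "real (t ^ 2) \<le> real (card P + (\<Sum>d=2..t. (t div d) ^ 2))"
    by (rule of_nat_mono)
  also have "\<dots> = real (card P) + (\<Sum>d=2..t. real (t div d) ^ 2)"
    by simp
  also have "(\<Sum>d=2..t. real (t div d) ^ 2) \<le> (\<Sum>d=2..t. real t ^ 2 * (1 / real d ^ 2))"
  proof (rule sum_mono)
    fix d
    have "real (t div d) ^ 2 \<le> (real t / real d) ^ 2"
      by (intro power_mono of_nat_div_le_of_nat) simp
    then show "real (t div d) ^ 2 \<le> real t ^ 2 * (1 / real d ^ 2)"
      by (simp add: power_divide)
  qed
  also have "\<dots> = real t ^ 2 * (\<Sum>d=2..t. 1 / real d ^ 2)"
    by (simp add: sum_distrib_left)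
  also have "\<dots> \<le> real t ^ 2 * (3 / 4)"
    by (rule mult_left_mono, rule order_trans[OF sum_inverse_squares_le[OF True]]) auto
  finally have "real (t ^ 2) \<le> real (4 * card P)"
    by simp
  then show ?thesis
    by (simp only: of_nat_le_iff)
qed

section \<open>The arrangement and its parameters\<close>

locale double_fan =
  fixes n k l :: nat
  assumes k_pos: "0 < k" and k_le_l: "k \<le> l" and l_le_n: "l \<le> n"
begin

text \<open>The term \<open>i^2\<close> gives strict convexity in \<open>i\<close>. The term
  \<open>n^2\<close> keeps exposed points on right sides clear of the left sides of the other
  triangles. The denominator makes every width at most \<open>1 / (8 * n^2)\<close>, small compared
  with the separation of joins that do not meet in a common point.\<close>

definition half_width :: "nat \<Rightarrow> real" where
  "half_width i = (real i ^ 2 + real n ^ 2) / (16 * real n ^ 4)"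

text \<open>Signed horizontal distance of \<open>p\<close> from the line through
  \<open>(i, 0)\<close> and \<open>(j, 1)\<close>.\<close>

definition offset :: "nat \<Rightarrow> nat \<Rightarrow> point \<Rightarrow> real" where
  "offset i j p = fst p - real i * (1 - snd p) - real j * snd p"

definition bottom_pt :: "real \<Rightarrow> nat \<Rightarrow> point" where
  "bottom_pt \<sigma> i = (real i + \<sigma> * half_width i, 0)"

definition top_pt :: "nat \<Rightarrow> point" where
  "top_pt j = (real j, 1)"

definition side :: "real \<Rightarrow> nat \<Rightarrow> nat \<Rightarrow> point set" where
  "side \<sigma> i j = closed_segment (bottom_pt \<sigma> i) (top_pt j)"

definition base :: "nat \<Rightarrow> point set" where
  "base i = closed_segment (bottom_pt (- 1) i) (bottom_pt 1 i)"

text \<open>The bases close the triangles from below; one base serves all triangles with the same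
  \<open>i\<close>.\<close>

definition arr :: "point set set" where
  "arr = (\<lambda>(\<sigma>, i, j). side \<sigma> i j) ` ({- 1, 1} \<times> {..<k} \<times> {..<l}) \<union> base ` {..<k}"

text \<open>The open triangle bounded by the two sides and the base. Since widths are positive, the
  strict inequality forces \<open>snd p < 1\<close>.\<close>

definition tri :: "nat \<Rightarrow> nat \<Rightarrow> point set" where
  "tri i j = {p. 0 < snd p \<and> \<bar>offset i j p\<bar> < half_width i * (1 - snd p)}"

text \<open>For positive \<open>a\<close> and \<open>b\<close>, these index the joins through
  \<open>vtx a b s\<close>.\<close>

definition lines :: "nat \<Rightarrow> nat \<Rightarrow> nat \<Rightarrow> (nat \<times> nat) set" where
  "lines a b s = {(i, j). i < k \<and> j < l \<and> i * b + j * a = s}"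

definition vtx :: "nat \<Rightarrow> nat \<Rightarrow> nat \<Rightarrow> point" where
  "vtx a b s = (real s / real (a + b), real a / real (a + b))"

definition cell :: "nat \<Rightarrow> nat \<Rightarrow> nat \<Rightarrow> point set" where
  "cell a b s = \<Inter> ((\<lambda>(i, j). tri i j) ` lines a b s)"

text \<open>Two joins through the point confine the cell to its vicinity;
  \<open>a + b \<le> n\<close> makes the widths small relative to the distance from all other
  joins.\<close>

definition good :: "nat \<Rightarrow> nat \<Rightarrow> nat \<Rightarrow> bool" where
  "good a b s \<longleftrightarrow> 0 < a \<and> 0 < b \<and> a + b \<le> n \<and> 2 \<le> card (lines a b s)"

lemma n_pos: "0 < n"
  using k_pos k_le_l l_le_n by simp

lemma half_width_pos: "0 < half_width i"
  unfolding half_width_def using n_pos by (intro divide_pos_pos add_nonneg_pos) auto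

lemma half_width_le:
  assumes "i < k"
  shows "half_width i \<le> 1 / (8 * real n ^ 2)"
proof -
  have "real i ^ 2 \<le> real n ^ 2"
    using assms k_le_l l_le_n by (intro power_mono) auto
  then have "half_width i \<le> (2 * real n ^ 2) / (16 * real n ^ 4)"
    unfolding half_width_def by (intro divide_right_mono) auto
  also have "\<dots> = 1 / (8 * real n ^ 2)"
    using n_pos by (simp add: field_simps power4_eq_xxxx power2_eq_square)
  finally show ?thesis .
qed

lemma half_width_lt_half:
  assumes "i < k"
  shows "half_width i < 1 / 2"
proof -
  have "1 / (8 * real n ^ 2) \<le> 1 / 8"
    using n_pos by (simp add: field_simps)
  then show ?thesis
    using half_width_le[OF assms] by simp
qed

lemma mem_side:
  "p \<in> side \<sigma> i j \<longleftrightarrow>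
    0 \<le> snd p \<and> snd p \<le> 1 \<and> offset i j p = \<sigma> * half_width i * (1 - snd p)"
  unfolding side_def bottom_pt_def top_pt_def closed_segment_to_height_one offset_def
  by (auto simp: algebra_simps)

lemma mem_base:
  "p \<in> base i \<longleftrightarrow> snd p = 0 \<and> \<bar>fst p - real i\<bar> \<le> half_width i"
proof -
  have "real i + - 1 * half_width i \<le> real i + 1 * half_width i"
    using half_width_pos[of i] by simp
  then show ?thesis
    unfolding base_def bottom_pt_def by (subst closed_segment_height_zero) auto
qed

text \<open>Widths below \<open>1 / 2\<close> keep the point pairs around different integers
  disjoint.\<close>

lemma bottom_pt_inject:
  assumes "i < k" "i' < k" "\<sigma> \<in> {- 1, 1}" "\<sigma>' \<in> {- 1, 1}" "bottom_pt \<sigma> i = bottom_pt \<sigma>' i'"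
  shows "\<sigma> = \<sigma>' \<and> i = i'"
proof -
  have eq: "real i + \<sigma> * half_width i = real i' + \<sigma>' * half_width i'"
    using assms by (simp add: bottom_pt_def)
  have "\<bar>\<sigma> * half_width i\<bar> < 1 / 2" "\<bar>\<sigma>' * half_width i'\<bar> < 1 / 2"
    using assms half_width_lt_half[of i] half_width_lt_half[of i'] half_width_pos[of i]
      half_width_pos[of i'] by (auto simp: abs_mult)
  then have "\<bar>real i - real i'\<bar> < 1"
    using eq by linarith
  then have "i = i'"
    by linarith
  then show ?thesis
    using eq half_width_pos[of i] by simp
qed

lemma bottom_pt_neq_top_pt: "bottom_pt \<sigma> i \<noteq> top_pt j"
  by (simp add: bottom_pt_def top_pt_def)

lemma side_inject:
  assumes "i < k" "i' < k" "\<sigma> \<in> {- 1, 1}" "\<sigma>' \<in> {- 1, 1}" "side \<sigma> i j = side \<sigma>' i' j'"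
  shows "\<sigma> = \<sigma>' \<and> i = i' \<and> j = j'"
proof -
  have "{bottom_pt \<sigma> i, top_pt j} = {bottom_pt \<sigma>' i', top_pt j'}"
    using assms(5) unfolding side_def closed_segment_eq by simp
  then have "bottom_pt \<sigma> i = bottom_pt \<sigma>' i'" "top_pt j = top_pt j'"
    using bottom_pt_neq_top_pt by (metis doubleton_eq_iff)+
  then show ?thesis
    using bottom_pt_inject[OF assms(1-4)] by (simp add: top_pt_def)
qed

lemma side_neq_base: "side \<sigma> i j \<noteq> base i'"
proof
  assume "side \<sigma> i j = base i'"
  moreover have "top_pt j \<in> side \<sigma> i j"
    by (simp add: side_def)
  ultimately show False
    by (simp add: mem_base top_pt_def)
qed

lemma side_in_arr: "\<lbrakk>\<sigma> \<in> {- 1, 1}; i < k; j < l\<rbrakk> \<Longrightarrow> side \<sigma> i j \<in> arr"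
  unfolding arr_def by force

lemma base_in_arr: "i < k \<Longrightarrow> base i \<in> arr"
  unfolding arr_def by auto

lemma arrE:
  assumes "s \<in> arr"
  obtains \<sigma> i j where "\<sigma> \<in> {- 1, 1}" "i < k" "j < l" "s = side \<sigma> i j"
  | i where "i < k" "s = base i"
  using assms unfolding arr_def by auto

section \<open>Validity of the arrangement and its endpoints\<close>

lemma segment_arrangement_arr: "segment_arrangement arr"
proof -
  have bottom_neq: "bottom_pt (- 1) i \<noteq> bottom_pt 1 i" for i
    using half_width_pos[of i] by (simp add: bottom_pt_def)
  have "\<exists>p q. p \<noteq> q \<and> s = closed_segment p q" if "s \<in> arr" for s
    using that
  proof (cases rule: arrE)
    case (1 \<sigma> i j)
    then show ?thesis
      using bottom_pt_neq_top_pt unfolding side_def by blast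
  next
    case (2 i)
    then show ?thesis
      using bottom_neq[of i] unfolding base_def by blast
  qed
  moreover have "finite arr"
    unfolding arr_def by auto
  ultimately show ?thesis
    unfolding segment_arrangement_def by blast
qed

lemma endpoints_arr:
  "endpoints arr = (\<lambda>(\<sigma>, i). bottom_pt \<sigma> i) ` ({- 1, 1} \<times> {..<k}) \<union> top_pt ` {..<l}" (is "_ = ?R")
proof (intro equalityI subsetI)
  fix p assume "p \<in> endpoints arr"
  then obtain q where "closed_segment p q \<in> arr"
    unfolding endpoints_def by blast
  then show "p \<in> ?R"
  proof (cases rule: arrE)
    case (1 \<sigma> i j)
    then have "p = bottom_pt \<sigma> i \<or> p = top_pt j"
      unfolding side_def closed_segment_eq by (metis doubleton_eq_iff)
    then show ?thesis
      using 1(1-3) by force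
  next
    case (2 i)
    then have "p = bottom_pt (- 1) i \<or> p = bottom_pt 1 i"
      unfolding base_def closed_segment_eq by (metis doubleton_eq_iff)
    then show ?thesis
      using 2(1) by force
  qed
next
  have ends: "bottom_pt \<sigma> i \<in> endpoints arr \<and> top_pt j \<in> endpoints arr"
    if "\<sigma> \<in> {- 1, 1}" "i < k" "j < l" for \<sigma> i j
    using side_in_arr[OF that] bottom_pt_neq_top_pt[of \<sigma> i j]
    unfolding endpoints_def side_def mem_Collect_eq by (metis closed_segment_commute)
  have "0 < l"
    using k_pos k_le_l by simp
  fix p assume "p \<in> ?R"
  then consider \<sigma> i where "\<sigma> \<in> {- 1, 1}" "i < k" "p = bottom_pt \<sigma> i"
    | j where "j < l" "p = top_pt j"
    by auto
  then show "p \<in> endpoints arr"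
  proof cases
    case (1 \<sigma> i)
    then show ?thesis
      using ends[of \<sigma> i 0] \<open>0 < l\<close> by simp
  next
    case (2 j)
    then show ?thesis
      using ends[of 1 0 j] k_pos by simp
  qed
qed

lemma card_endpoints_arr: "card (endpoints arr) = 2 * k + l"
proof -
  have "inj_on (\<lambda>(\<sigma>, i). bottom_pt \<sigma> i) ({- 1, 1} \<times> {..<k})"
  proof (rule inj_onI)
    fix x y
    assume "x \<in> {- 1, 1} \<times> {..<k}" "y \<in> {- 1, 1} \<times> {..<k}"
      "(\<lambda>(\<sigma>, i). bottom_pt \<sigma> i) x = (\<lambda>(\<sigma>, i). bottom_pt \<sigma> i) y"
    then show "x = y"
      using bottom_pt_inject[of "snd x" "snd y" "fst x" "fst y"]
      by (simp add: case_prod_beta prod_eq_iff mem_Times_iff)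
  qed
  then have "card ((\<lambda>(\<sigma>, i). bottom_pt \<sigma> i) ` ({- 1, 1} \<times> {..<k})) = 2 * k"
    by (simp add: card_image card_cartesian_product)
  moreover have "inj top_pt"
    by (simp add: inj_on_def top_pt_def)
  then have "card (top_pt ` {..<l}) = l"
    by (metis card_image card_lessThan inj_on_subset subset_UNIV)
  moreover have "(\<lambda>(\<sigma>, i). bottom_pt \<sigma> i) ` ({- 1, 1} \<times> {..<k}) \<inter> top_pt ` {..<l} = {}"
    by (auto simp: bottom_pt_def top_pt_def)
  ultimately show ?thesis
    unfolding endpoints_arr by (subst card_Un_disjoint) auto
qed

section \<open>Topology of the open triangles\<close>

lemma tri_as_Int:
  "tri i j = {p. 0 < snd p} \<inter> {p. offset i j p < half_width i * (1 - snd p)}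
     \<inter> {p. - half_width i * (1 - snd p) < offset i j p}"
  unfolding tri_def by auto

lemma open_tri: "open (tri i j)"
  unfolding tri_as_Int offset_def
  by (intro open_Int open_Collect_less continuous_intros)

lemma affine_offset:
  "offset i j ((1 - u) *\<^sub>R p + u *\<^sub>R q) = (1 - u) * offset i j p + u * offset i j q"
  unfolding offset_def by (simp add: algebra_simps)

text \<open>A convex combination of a strict and a weak inequality is strict as long as the strict
  one has positive weight. With \<open>q\<close> in the closed triangle this serves both convexity
  and the closure of the triangle.\<close>

lemma tri_segment:
  assumes "p \<in> tri i j" "0 \<le> snd q" "\<bar>offset i j q\<bar> \<le> half_width i * (1 - snd q)" "0 \<le> u" "u < 1"
  shows "(1 - u) *\<^sub>R p + u *\<^sub>R q \<in> tri i j"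
proof -
  have "0 < (1 - u) * snd p" "0 \<le> u * snd q"
    using assms by (auto simp: tri_def)
  moreover have "\<bar>(1 - u) * offset i j p + u * offset i j q\<bar>
      \<le> (1 - u) * \<bar>offset i j p\<bar> + u * \<bar>offset i j q\<bar>"
    using assms(4,5) by (simp add: abs_mult order_trans[OF abs_triangle_ineq])
  moreover have "(1 - u) * \<bar>offset i j p\<bar> < (1 - u) * (half_width i * (1 - snd p))"
    using assms by (intro mult_strict_left_mono) (auto simp: tri_def)
  moreover have "u * \<bar>offset i j q\<bar> \<le> u * (half_width i * (1 - snd q))"
    using assms by (intro mult_left_mono) auto
  moreover have "(1 - u) * (half_width i * (1 - snd p)) + u * (half_width i * (1 - snd q))
      = half_width i * (1 - snd ((1 - u) *\<^sub>R p + u *\<^sub>R q))"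
    by (simp add: algebra_simps)
  ultimately show ?thesis
    unfolding tri_def mem_Collect_eq affine_offset by simp
qed

lemma convex_tri: "convex (tri i j)"
proof (unfold convex_alt, intro ballI allI impI)
  fix p q and u :: real
  assume "p \<in> tri i j" "q \<in> tri i j" "0 \<le> u \<and> u \<le> 1"
  then show "(1 - u) *\<^sub>R p + u *\<^sub>R q \<in> tri i j"
    using tri_segment[of p i j q u] by (cases "u = 1") (auto simp: tri_def)
qed

text \<open>Closure points satisfy the weak inequalities, so a point outside the open triangle turns
  one of them into an equality, which names a segment.\<close>

lemma frontier_tri: "frontier (tri i j) \<subseteq> side 1 i j \<union> side (- 1) i j \<union> base i"
proof
  fix p assume p: "p \<in> frontier (tri i j)"
  let ?T = "{p. 0 \<le> snd p} \<inter> {p. offset i j p \<le> half_width i * (1 - snd p)}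
     \<inter> {p. - half_width i * (1 - snd p) \<le> offset i j p}"
  have "closed ?T"
    unfolding offset_def by (intro closed_Int closed_Collect_le continuous_intros)
  then have "closure (tri i j) \<subseteq> ?T"
    by (rule closure_minimal[rotated]) (auto simp: tri_def)
  then have T: "p \<in> ?T" and "p \<notin> tri i j"
    using p open_tri by (auto simp: frontier_def interior_open)
  have "0 \<le> half_width i * (1 - snd p)"
    using T by auto
  then have le1: "snd p \<le> 1"
    using half_width_pos[of i] by (simp add: zero_le_mult_iff)
  show "p \<in> side 1 i j \<union> side (- 1) i j \<union> base i"
  proof (cases "snd p = 0")
    case True
    then show ?thesis
      using T by (auto simp: mem_base offset_def)
  next
    case False
    then show ?thesis
      using T \<open>p \<notin> tri i j\<close> le1 by (auto simp: mem_side tri_def)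
  qed
qed

text \<open>The trapping principle, used both for the maximality of cells and to hold an edge inside
  a triangle.\<close>

lemma connected_subset_tri:
  assumes "connected T" "T \<inter> tri i j \<noteq> {}" "T \<inter> (side 1 i j \<union> side (- 1) i j \<union> base i) = {}"
  shows "T \<subseteq> tri i j"
  using connected_Int_frontier[OF assms(1,2)] frontier_tri assms(3) by blast

lemma tri_Int_side:
  assumes "\<sigma> \<in> {- 1, 1}"
  shows "tri i j \<inter> side \<sigma> i j = {}"
  using assms half_width_pos[of i] by (auto simp: tri_def mem_side abs_mult)

lemma tri_Int_base: "tri i j \<inter> base i' = {}"
  by (auto simp: tri_def mem_base)

lemma side_subset_closure_tri:
  assumes "\<sigma> \<in> {- 1, 1}"
  shows "side \<sigma> i j \<subseteq> closure (tri i j)"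
proof
  fix q assume q: "q \<in> side \<sigma> i j"
  \<comment> \<open>The midpoint of the join is an interior point from which every point of a side
    is reached through the triangle.\<close>
  define c :: point where "c = ((real i + real j) / 2, 1 / 2)"
  have c: "c \<in> tri i j"
    using half_width_pos[of i] by (simp add: c_def tri_def offset_def field_simps)
  have "c \<noteq> q"
    using c q tri_Int_side[OF assms, of i j] by blast
  have "(1 - u) *\<^sub>R c + u *\<^sub>R q \<in> tri i j" if "0 \<le> u" "u < 1" for u
    using that q assms half_width_pos[of i]
    by (intro tri_segment[OF c]) (auto simp: mem_side abs_mult)
  then have "open_segment c q \<subseteq> tri i j"
    by (auto simp: in_segment)
  then have "closure (open_segment c q) \<subseteq> closure (tri i j)"
    by (rule closure_mono)
  then show "q \<in> closure (tri i j)"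
    using \<open>c \<noteq> q\<close> by (auto simp: closure_open_segment)
qed

section \<open>Joins through a common point and distance to all others\<close>

lemma finite_lines: "finite (lines a b s)"
  by (rule finite_subset[of _ "{..<k} \<times> {..<l}"]) (auto simp: lines_def)

text \<open>Expansion around \<open>vtx a b s\<close>: both brackets vanish there exactly when
  \<open>i * b + j * a = s\<close>, and \<open>i - j\<close> is the coefficient of the vertical
  displacement.\<close>

lemma offset_scaled:
  "real (a + b) * offset i j p =
     (real (a + b) * fst p - real (i * b + j * a)) +
     (real i - real j) * (real (a + b) * snd p - real a)"
  unfolding offset_def by (simp add: algebra_simps)

text \<open>Equal differences \<open>i - j\<close> would make the joins parallel, and parallel joins
  through a common point coincide. The differences are integers, hence at least 1 apart.\<close>

lemma lines_differ:
  assumes "0 < a" "0 < b" "(i, j) \<in> lines a b s" "(i', j') \<in> lines a b s" "(i, j) \<noteq> (i', j')"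
  shows "i \<noteq> i'" "1 \<le> \<bar>(real i - real j) - (real i' - real j')\<bar>"
proof -
  have eq: "i * b + j * a = i' * b + j' * a"
    using assms by (auto simp: lines_def)
  then show "i \<noteq> i'"
    using assms by auto
  have "int i - int j \<noteq> int i' - int j'"
  proof
    assume d: "int i - int j = int i' - int j'"
    have "(int i - int i') * int b + (int j - int j') * int a = 0"
      using arg_cong[OF eq, of int] by (simp add: algebra_simps)
    moreover have "int j - int j' = int i - int i'"
      using d by simp
    ultimately have "(int i - int i') * int (a + b) = 0"
      by (simp add: algebra_simps)
    then show False
      using assms(1) \<open>i \<noteq> i'\<close> by simp
  qed
  then have "1 \<le> \<bar>(int i - int j) - (int i' - int j')\<bar>"
    by linarith
  then show "1 \<le> \<bar>(real i - real j) - (real i' - real j')\<bar>"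
    by linarith
qed

lemma far_from_other_lines:
  assumes "good a b s" "p \<in> side 1 i j \<union> tri i j" "p \<in> side 1 i' j' \<union> tri i' j'"
    and "(i, j) \<in> lines a b s" "(i', j') \<in> lines a b s" "(i, j) \<noteq> (i', j')"
    and "i'' < k" "j'' < l" "i'' * b + j'' * a \<noteq> s"
  shows "half_width i'' * (1 - snd p) < \<bar>offset i'' j'' p\<bar>"
proof -
  define E where "E = 1 / (8 * real n ^ 2)"
  \<comment> \<open>\<open>X\<close> and \<open>Q\<close> are the coordinates of \<open>p\<close>
    relative to \<open>vtx a b s\<close>, scaled by \<open>q\<close>.\<close>
  define q where "q = real (a + b)"
  define Q where "Q = q * snd p - real a"
  define X where "X = q * fst p - real s"
  have q: "0 < q" "q \<le> real n" and a: "0 < a" "0 < b"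
    using assms(1) by (auto simp: good_def q_def)
  have E: "0 < E"
    using n_pos by (simp add: E_def)
  have p01: "0 \<le> snd p" "snd p \<le> 1"
    using assms(2) half_width_pos[of i] by (auto simp: mem_side tri_def)
      (smt (verit) mult_less_0_iff)
  have scaled: "half_width i * (1 - snd p) \<le> E" if "i < k" for i
  proof -
    have "half_width i * (1 - snd p) \<le> half_width i * 1"
      using half_width_pos[of i] p01 by (intro mult_left_mono) auto
    then show ?thesis
      using half_width_le[OF that] by (simp add: E_def)
  qed
  have close: "\<bar>offset i j p\<bar> \<le> E"
    if "p \<in> side 1 i j \<union> tri i j" "(i, j) \<in> lines a b s" for i j
  proof -
    have "\<bar>offset i j p\<bar> \<le> half_width i * (1 - snd p)"
      using that(1) half_width_pos[of i] p01 by (auto simp: mem_side tri_def)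
    then show ?thesis
      using scaled[of i] that(2) by (auto simp: lines_def)
  qed
  have on_line: "q * offset i j p = X + (real i - real j) * Q" if "(i, j) \<in> lines a b s" for i j
    using that offset_scaled[of a b i j p] by (auto simp: lines_def q_def Q_def X_def)
  have slope: "\<bar>real i - real j\<bar> \<le> real n" if "i < k" "j < l" for i j
    using that k_le_l l_le_n by linarith
  \<comment> \<open>Subtracting the two joins eliminates \<open>X\<close>; since their directions
    differ by at least 1, \<open>Q\<close> is small, and then so is \<open>X\<close>.\<close>
  have "((real i - real j) - (real i' - real j')) * Q = q * offset i j p - q * offset i' j' p"
    using on_line assms(4,5) by (simp add: algebra_simps)
  then have "\<bar>(real i - real j) - (real i' - real j')\<bar> * \<bar>Q\<bar> = q * \<bar>offset i j p - offset i' j' p\<bar>"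
    using q by (simp add: abs_mult[symmetric] right_diff_distrib[symmetric]) (simp add: abs_mult)
  also have "\<dots> \<le> q * (2 * E)"
    using q close assms(2-5) by (intro mult_left_mono) (smt (verit))+
  finally have "\<bar>(real i - real j) - (real i' - real j')\<bar> * \<bar>Q\<bar> \<le> q * (2 * E)" .
  moreover have "1 * \<bar>Q\<bar> \<le> \<bar>(real i - real j) - (real i' - real j')\<bar> * \<bar>Q\<bar>"
    using lines_differ(2)[OF a assms(4-6)] by (intro mult_right_mono) auto
  ultimately have Q: "\<bar>Q\<bar> \<le> q * (2 * E)"
    by simp
  have slopeQ: "\<bar>(real i - real j) * Q\<bar> \<le> real n * (q * (2 * E))" if "i < k" "j < l" for i j
    unfolding abs_mult using slope[OF that] Q by (intro mult_mono) auto
  have "\<bar>q * offset i j p\<bar> \<le> q * E"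
    using q close[OF assms(2,4)] by (simp add: abs_mult)
  moreover have "\<bar>(real i - real j) * Q\<bar> \<le> real n * (q * (2 * E))"
    using slopeQ assms(4) by (auto simp: lines_def)
  ultimately have X: "\<bar>X\<bar> \<le> q * E + real n * (q * (2 * E))"
    using on_line[OF assms(4)] by linarith
  have "q * offset i'' j'' p = X + (real s - real (i'' * b + j'' * a)) + (real i'' - real j'') * Q"
    using offset_scaled[of a b i'' j'' p] by (simp add: q_def Q_def X_def)
  moreover have "1 \<le> \<bar>real s - real (i'' * b + j'' * a)\<bar>"
    using assms(9) by linarith
  ultimately have "1 - (q * E + 2 * (real n * (q * (2 * E)))) \<le> \<bar>q * offset i'' j'' p\<bar>"
    using X slopeQ[OF assms(7,8)] by linarith
  \<comment> \<open>With \<open>q \<le> n\<close> the two terms are at most \<open>1 / 4\<close> and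
    \<open>1 / 2\<close>.\<close>
  moreover have "2 * (q * E) + 2 * (real n * (q * (2 * E))) < 1"
  proof -
    have "q * E \<le> real n * E"
      using q E by simp
    moreover have "real n * (q * (2 * E)) \<le> real n * (real n * (2 * E))"
      using q E by (intro mult_left_mono mult_right_mono) auto
    moreover have "real n * (real n * (2 * E)) = 1 / 4"
      using n_pos by (simp add: E_def power2_eq_square)
    moreover have "real n * E \<le> 1 / 8"
      using n_pos by (simp add: E_def power2_eq_square)
    ultimately show ?thesis
      using E q n_pos
      by linarith
  qed
  moreover have "\<bar>q * offset i'' j'' p\<bar> = q * \<bar>offset i'' j'' p\<bar>"
    using q by (simp add: abs_mult)
  ultimately have "q * E < q * \<bar>offset i'' j'' p\<bar>"
    by linarith
  then have "E < \<bar>offset i'' j'' p\<bar>"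
    using q by simp
  then show ?thesis
    using scaled[OF assms(7)] by simp
qed

lemma goodE:
  assumes "good a b s"
  obtains i j i' j' where "(i, j) \<in> lines a b s" "(i', j') \<in> lines a b s" "(i, j) \<noteq> (i', j')"
proof -
  have "\<not> card (lines a b s) \<le> Suc 0"
    using assms by (simp add: good_def)
  then show thesis
    using that finite_lines[of a b s] by (auto simp: card_le_Suc0_iff_eq)
qed

section \<open>Cells around the common points\<close>

lemma vtx_in_cell:
  assumes "good a b s"
  shows "vtx a b s \<in> cell a b s"
proof -
  have "vtx a b s \<in> tri i j" if "(i, j) \<in> lines a b s" for i j
  proof -
    have ab: "0 < a" "0 < b"
      using assms by (auto simp: good_def)
    then have "real (a + b) * offset i j (vtx a b s) = 0"
      using that unfolding offset_scaled by (simp add: vtx_def lines_def)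
    then have "offset i j (vtx a b s) = 0"
      using ab by simp
    then show ?thesis
      using ab half_width_pos[of i] by (simp add: tri_def vtx_def field_simps)
  qed
  then show ?thesis
    by (auto simp: cell_def)
qed

lemma cell_subset_tri: "(i, j) \<in> lines a b s \<Longrightarrow> cell a b s \<subseteq> tri i j"
  by (auto simp: cell_def)

lemma convex_cell: "convex (cell a b s)"
  unfolding cell_def using convex_tri by (intro convex_INT) auto

lemma open_cell: "open (cell a b s)"
  unfolding cell_def using finite_lines open_tri by (intro open_INT) auto

text \<open>Contrapositive of \<open>far_from_other_lines\<close> inside a cell. The value
  \<open>\<sigma> = 1\<close> treats both sides of a triangle, \<open>\<sigma> = 0\<close> the join
  itself.\<close>

lemma side_through_cell:
  assumes "good a b s" "p \<in> cell a b s" "i < k" "j < l" "0 \<le> \<sigma>" "\<sigma> \<le> 1"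
    and "\<bar>offset i j p\<bar> \<le> \<sigma> * half_width i * (1 - snd p)"
  shows "i * b + j * a = s"
proof (rule ccontr)
  assume ne: "i * b + j * a \<noteq> s"
  obtain i1 j1 i2 j2 where L: "(i1, j1) \<in> lines a b s" "(i2, j2) \<in> lines a b s"
    "(i1, j1) \<noteq> (i2, j2)"
    using goodE[OF assms(1)] by metis
  then have p: "p \<in> side 1 i1 j1 \<union> tri i1 j1" "p \<in> side 1 i2 j2 \<union> tri i2 j2"
    using assms(2) cell_subset_tri by blast+
  have far: "half_width i * (1 - snd p) < \<bar>offset i j p\<bar>"
    by (rule far_from_other_lines[OF assms(1) p L assms(3,4) ne])
  have "0 < half_width i1 * (1 - snd p)"
    using L(1) assms(2) cell_subset_tri by (fastforce simp: tri_def)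
  then have "0 < 1 - snd p"
    using half_width_pos[of i1] by (simp add: zero_less_mult_iff)
  then have "\<sigma> * (half_width i * (1 - snd p)) \<le> 1 * (half_width i * (1 - snd p))"
    using assms(6) half_width_pos[of i] by (intro mult_right_mono) auto
  then show False
    using assms(7) far by (simp add: mult.assoc)
qed

text \<open>Sides of the defining triangles miss the cell because the triangles are open, all other
  sides are too far away, and bases lie at height 0.\<close>

lemma cell_Int_arr:
  assumes "good a b s"
  shows "cell a b s \<inter> \<Union> arr = {}"
proof (intro equals0I, elim IntE UnionE)
  fix p t assume p: "p \<in> cell a b s" and "p \<in> t" "t \<in> arr"
  from \<open>t \<in> arr\<close> show False
  proof (cases rule: arrE)
    case (1 \<sigma> i j)
    then have "\<bar>offset i j p\<bar> \<le> 1 * half_width i * (1 - snd p)"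
      using \<open>p \<in> t\<close> half_width_pos[of i] by (auto simp: mem_side abs_mult)
    then have "(i, j) \<in> lines a b s"
      using side_through_cell[OF assms p 1(2,3), of 1] 1(2,3) by (simp add: lines_def)
    then show False
      using p \<open>p \<in> t\<close> 1 cell_subset_tri tri_Int_side by blast
  next
    case (2 i)
    obtain i1 j1 where "(i1, j1) \<in> lines a b s"
      using goodE[OF assms] by metis
    then show False
      using p \<open>p \<in> t\<close> 2 cell_subset_tri tri_Int_base by blast
  qed
qed

text \<open>For maximality, a connected set avoiding the arrangement and containing the cell cannot
  leave any of the defining triangles.\<close>

lemma cell_in_cells:
  assumes "good a b s"
  shows "cell a b s \<in> cells arr"
  unfolding cells_def in_components_maximal
proof (intro conjI allI impI)
  show "cell a b s \<noteq> {}"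
    using vtx_in_cell[OF assms] by blast
  show "cell a b s \<subseteq> - \<Union> arr"
    using cell_Int_arr[OF assms] by blast
  show "connected (cell a b s)"
    using convex_cell by (rule convex_connected)
  fix T assume T: "T \<noteq> {} \<and> cell a b s \<subseteq> T \<and> T \<subseteq> - \<Union> arr \<and> connected T"
  have "T \<subseteq> tri i j" if "(i, j) \<in> lines a b s" for i j
  proof (rule connected_subset_tri)
    show "T \<inter> tri i j \<noteq> {}"
      using vtx_in_cell[OF assms] cell_subset_tri[OF that] T by blast
    have "side 1 i j \<in> arr" "side (- 1) i j \<in> arr" "base i \<in> arr"
      using that side_in_arr base_in_arr by (auto simp: lines_def)
    then show "T \<inter> (side 1 i j \<union> side (- 1) i j \<union> base i) = {}"
      using T by blast
  qed (use T in auto)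
  then show "T = cell a b s"
    using T by (auto simp: cell_def)
qed

text \<open>The sides \<open>side 1 i j\<close> with \<open>(i, j)\<close> in \<open>lines a b s\<close> form a family whose offsets at a fixed
  height are quadratic in \<open>i\<close> with positive leading coefficient; the height below is the one at
  which this quadratic has its minimum at the given \<open>i\<close>.\<close>

lemma ex_exposed_point:
  assumes "good a b s" "(i, j) \<in> lines a b s"
  shows "\<exists>p \<in> side 1 i j. 0 < snd p \<and> snd p < 1 \<and>
    (\<forall>i' j'. (i', j') \<in> lines a b s \<longrightarrow> (i', j') \<noteq> (i, j) \<longrightarrow> p \<in> tri i' j')"
proof -
  have ab: "0 < a" "0 < b"
    using assms by (auto simp: good_def)
  define q where "q = real (a + b)"
  define \<epsilon> where "\<epsilon> = 1 / (16 * real n ^ 4)"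
  \<comment> \<open>Vanishing of the derivative at \<open>i\<close> reads
    \<open>q * y - a = 2 * i * a * \<epsilon> * (1 - y)\<close>; the next definition solves this for
    \<open>y\<close>.\<close>
  define \<tau> where "\<tau> = 2 * real i * (real a / q) * \<epsilon>"
  define y where "y = (real a / q + \<tau>) / (1 + \<tau>)"
  define p :: point where "p = (real i * (1 - y) + real j * y + half_width i * (1 - y), y)"
  have q: "0 < q" "real a < q"
    using ab by (auto simp: q_def)
  have \<epsilon>: "0 < \<epsilon>"
    using n_pos by (simp add: \<epsilon>_def)
  have hw: "half_width i = \<epsilon> * (real i ^ 2 + real n ^ 2)" for i
    by (simp add: half_width_def \<epsilon>_def)
  have \<tau>: "0 \<le> \<tau>"
    using q \<epsilon> by (simp add: \<tau>_def)
  have y: "0 < y" "y < 1"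
    using \<tau> q ab by (simp_all add: y_def add_pos_nonneg)
  have "y * (1 + \<tau>) = real a / q + \<tau>"
    using \<tau> by (simp add: y_def)
  then have "q * y - real a = q * \<tau> * (1 - y)"
    using q by (simp add: field_simps)
  then have qy: "q * y - real a = 2 * real i * real a * \<epsilon> * (1 - y)"
    using q by (simp add: \<tau>_def)
  have "p \<in> side 1 i j"
    using y by (simp add: mem_side p_def offset_def)
  moreover have "p \<in> tri i' j'" if L: "(i', j') \<in> lines a b s" "(i', j') \<noteq> (i, j)" for i' j'
  proof -
    have "i \<noteq> i'"
      using lines_differ(1)[OF ab assms(2) L(1)] L(2) by auto
    have "real (i * b + j * a) = real (i' * b + j' * a)"
      using L assms(2) by (auto simp: lines_def)
    then have ja: "(real j - real j') * real a = - (real i - real i') * real b"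
      by (simp add: algebra_simps)
    have "real a * ((real i - real i') * (1 - y) + (real j - real j') * y)
        = (real i - real i') * real a * (1 - y) + ((real j - real j') * real a) * y"
      by (simp add: algebra_simps)
    also have "\<dots> = - (real i - real i') * (q * y - real a)"
      unfolding ja q_def by (simp add: algebra_simps)
    also have "\<dots> = real a * (2 * \<epsilon> * real i * (real i' - real i) * (1 - y))"
      unfolding qy by (simp add: algebra_simps)
    finally have "(real i - real i') * (1 - y) + (real j - real j') * y
        = 2 * \<epsilon> * real i * (real i' - real i) * (1 - y)"
      using ab by simp
    then have "offset i' j' p = half_width i * (1 - y) + 2 * \<epsilon> * real i * (real i' - real i) * (1 - y)"
      by (simp add: offset_def p_def algebra_simps)
    \<comment> \<open>Completing the square shows that \<open>p\<close> lies left of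
      \<open>side 1 i' j'\<close> by exactly
      \<open>\<epsilon> * (1 - y) * (i' - i)^2\<close>.\<close>
    also have "\<dots> = \<epsilon> * (1 - y) * (real n ^ 2 + real i' ^ 2 - (real i' - real i) ^ 2)"
      unfolding hw by (simp add: algebra_simps power2_eq_square)
    finally have off: "offset i' j' p = \<epsilon> * (1 - y) * (real n ^ 2 + real i' ^ 2 - (real i' - real i) ^ 2)" .
    \<comment> \<open>This bound keeps \<open>p\<close> to the right of the left side of the same
      triangle.\<close>
    have "\<bar>real i' - real i\<bar> \<le> real n"
      using L assms(2) k_le_l l_le_n by (auto simp: lines_def)
    then have "(real i' - real i) ^ 2 \<le> real n ^ 2"
      using abs_le_square_iff[of "real i' - real i" "real n"] by simp
    moreover have "0 < (real i' - real i) ^ 2" "0 < real n ^ 2"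
      using \<open>i \<noteq> i'\<close> n_pos by auto
    ultimately have "\<bar>real n ^ 2 + real i' ^ 2 - (real i' - real i) ^ 2\<bar> < real n ^ 2 + real i' ^ 2"
      using zero_le_power2[of "real i'"] by linarith
    then have "\<epsilon> * (1 - y) * \<bar>real n ^ 2 + real i' ^ 2 - (real i' - real i) ^ 2\<bar>
        < \<epsilon> * (1 - y) * (real n ^ 2 + real i' ^ 2)"
      using \<epsilon> y by (intro mult_strict_left_mono) auto
    then have "\<bar>offset i' j' p\<bar> < half_width i' * (1 - y)"
      unfolding off hw using \<epsilon> y by (simp add: abs_mult mult_ac add.commute)
    then show ?thesis
      using y by (simp add: tri_def p_def)
  qed
  ultimately show ?thesis
    using y by (intro bexI[of _ p]) (auto simp: p_def)
qed

section \<open>Incidence of sides with the cells\<close>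

text \<open>The exposed point lies on no other segment, so it belongs to an edge of its side. That
  edge meets no other segment and is trapped in all the other triangles of the cell.\<close>

lemma incident_cell:
  assumes "good a b s" "(i, j) \<in> lines a b s"
  shows "incident arr (side 1 i j) (closure (cell a b s))"
proof -
  have ij: "i < k" "j < l"
    using assms(2) by (auto simp: lines_def)
  obtain p where p: "p \<in> side 1 i j" "0 < snd p" "snd p < 1"
    and p_tri: "\<And>i' j'. (i', j') \<in> lines a b s \<Longrightarrow> (i', j') \<noteq> (i, j) \<Longrightarrow> p \<in> tri i' j'"
    using ex_exposed_point[OF assms] by blast
  obtain i2 j2 where L2: "(i2, j2) \<in> lines a b s" "(i2, j2) \<noteq> (i, j)"
    using goodE[OF assms(1)] by metis
  have p_not: "p \<notin> t" if "t \<in> arr" "t \<noteq> side 1 i j" for t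
    using that(1)
  proof (cases rule: arrE)
    case (1 \<sigma> i' j')
    show ?thesis
    proof (cases "(i', j') \<in> lines a b s")
      case True
      show ?thesis
      proof (cases "(i', j') = (i, j)")
        case True
        then have "\<sigma> = - 1"
          using 1 that(2) by auto
        moreover have "0 < half_width i * (1 - snd p)"
          using p half_width_pos[of i] by simp
        ultimately show ?thesis
          using p True 1 by (auto simp: mem_side)
      next
        case False
        then show ?thesis
          using p_tri[OF True False] tri_Int_side[OF 1(1), of i' j'] 1 by blast
      qed
    next
      case False
      \<comment> \<open>\<open>p\<close> lies on \<open>side 1 i j\<close> and in the triangle of a
        second join, as the distance estimate requires.\<close>
      then have "half_width i' * (1 - snd p) < \<bar>offset i' j' p\<bar>"
        using far_from_other_lines[OF assms(1) _ _ assms(2) L2(1) _ 1(2,3), of p]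
          p p_tri[OF L2] L2 1 by (auto simp: lines_def)
      then show ?thesis
        using 1 half_width_pos[of i'] p by (auto simp: mem_side abs_mult)
    qed
  next
    case (2 i')
    then show ?thesis
      using p by (simp add: mem_base)
  qed
  define e where "e = connected_component_set (side 1 i j - vertices arr) p"
  have "p \<notin> vertices arr"
    using p_not unfolding vertices_def by blast
  then have pe: "p \<in> side 1 i j - vertices arr"
    using p by blast
  have side_arr: "side 1 i j \<in> arr"
    using side_in_arr ij by simp
  have e: "e \<in> edges arr"
    using pe side_arr unfolding edges_def e_def by (auto intro: componentsI)
  have e_sub: "e \<subseteq> side 1 i j - vertices arr"
    unfolding e_def by (rule connected_component_subset)
  have e_avoids: "e \<inter> t = {}" if "t \<in> arr" "t \<noteq> side 1 i j" for t
    using e_sub side_arr that unfolding vertices_def by blast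
  have e_tri: "e \<subseteq> tri i' j'" if L: "(i', j') \<in> lines a b s" "(i', j') \<noteq> (i, j)" for i' j'
  proof (rule connected_subset_tri)
    show "connected e"
      unfolding e_def by (rule connected_connected_component)
    show "e \<inter> tri i' j' \<noteq> {}"
      using p_tri[OF L] pe unfolding e_def by (metis connected_component_refl disjoint_iff mem_Collect_eq)
    have ij': "i' < k" "j' < l"
      using L by (auto simp: lines_def)
    have "e \<inter> side \<sigma> i' j' = {}" if "\<sigma> \<in> {- 1, 1}" for \<sigma>
      using side_inject[OF ij'(1) ij(1) that, of 1 j' j] L(2) that ij'
      by (intro e_avoids side_in_arr) auto
    moreover have "e \<inter> base i' = {}"
      using ij' side_neq_base by (intro e_avoids base_in_arr) metis+
    ultimately show "e \<inter> (side 1 i' j' \<union> side (- 1) i' j' \<union> base i') = {}"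
      by auto
  qed
  \<comment> \<open>Closure commutes with the intersection because the triangles are convex, open
    and share \<open>vtx a b s\<close>.\<close>
  have "closure (cell a b s) = \<Inter> (closure ` (\<lambda>(i, j). tri i j) ` lines a b s)"
    using vtx_in_cell[OF assms(1)] convex_tri open_tri unfolding cell_def
    by (subst closure_Inter_convex_open) auto
  moreover have "e \<subseteq> closure (tri i' j')" if "(i', j') \<in> lines a b s" for i' j'
  proof (cases "(i', j') = (i, j)")
    case True
    then show ?thesis
      using e_sub side_subset_closure_tri[of 1 i j] by auto
  next
    case False
    then show ?thesis
      using e_tri[OF that] closure_subset by blast
  qed
  ultimately have "e \<subseteq> closure (cell a b s)"
    by fast
  then show ?thesis
    using e e_sub unfolding incident_def by blast
qed

text \<open>Each join contributes its right side, and different joins have different right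
  sides.\<close>

lemma card_lines_le_face_complexity:
  assumes "good a b s"
  shows "card (lines a b s) \<le> face_complexity arr (closure (cell a b s))"
proof -
  have "inj_on (\<lambda>(i, j). side 1 i j) (lines a b s)"
  proof (rule inj_onI)
    fix x y assume "x \<in> lines a b s" "y \<in> lines a b s"
      "(\<lambda>(i, j). side 1 i j) x = (\<lambda>(i, j). side 1 i j) y"
    moreover obtain i j i' j' where "x = (i, j)" "y = (i', j')"
      by fastforce
    ultimately show "x = y"
      using side_inject[of i i' 1 1 j j'] by (simp add: lines_def)
  qed
  then have "card (lines a b s) = card ((\<lambda>(i, j). side 1 i j) ` lines a b s)"
    by (simp add: card_image)
  also have "\<dots> \<le> card {t \<in> arr. incident arr t (closure (cell a b s))}"
  proof (rule card_mono)
    show "finite {t \<in> arr. incident arr t (closure (cell a b s))}"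
      using segment_arrangement_arr by (simp add: segment_arrangement_def)
    show "(\<lambda>(i, j). side 1 i j) ` lines a b s \<subseteq> {t \<in> arr. incident arr t (closure (cell a b s))}"
    proof clarify
      fix i j assume L: "(i, j) \<in> lines a b s"
      then have "side 1 i j \<in> arr"
        using side_in_arr[of 1 i j] by (simp add: lines_def)
      then show "side 1 i j \<in> arr \<and> incident arr (side 1 i j) (closure (cell a b s))"
        using incident_cell[OF assms L] by simp
    qed
  qed
  finally show ?thesis
    by (simp add: face_complexity_def)
qed

section \<open>Distinct common points give distinct faces\<close>

text \<open>Two joins through a point fix the ratio \<open>a : b\<close> of its heights above and
  below; coprimality fixes \<open>a\<close> and \<open>b\<close>, and either join then fixes
  \<open>s\<close>.\<close>

lemma coprime_lines_determine:
  assumes "good a b s" "good a' b' s'" "coprime a b" "coprime a' b'"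
    and "lines a b s \<subseteq> lines a' b' s'"
  shows "(a, b, s) = (a', b', s')"
proof -
  have ab: "0 < a" "0 < b"
    using assms by (auto simp: good_def)
  obtain i j i' j' where L: "(i, j) \<in> lines a b s" "(i', j') \<in> lines a b s" "(i, j) \<noteq> (i', j')"
    using goodE[OF assms(1)] by metis
  have eqs: "i * b + j * a = s" "i' * b + j' * a = s" "i * b' + j * a' = s'" "i' * b' + j' * a' = s'"
    using L assms(5) by (auto simp: lines_def)
  have "int i * int b + int j * int a = int i' * int b + int j' * int a"
    "int i * int b' + int j * int a' = int i' * int b' + int j' * int a'"
    using eqs by (metis of_nat_add of_nat_mult)+
  then have d: "(int i - int i') * int b = (int j' - int j) * int a"
    "(int i - int i') * int b' = (int j' - int j) * int a'"
    by (simp_all add: algebra_simps)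
  have "(int i - int i') * (int a * int b') = int a * ((int i - int i') * int b')"
    by simp
  also have "\<dots> = int a' * ((int j' - int j) * int a)"
    unfolding d by simp
  also have "\<dots> = (int i - int i') * (int a' * int b)"
    unfolding d(1)[symmetric] by simp
  finally have "int a * int b' = int a' * int b"
    using lines_differ(1)[OF ab L] by simp
  then have cross: "a * b' = a' * b"
    by (metis of_nat_eq_iff of_nat_mult)
  have "a dvd a' * b" "a' dvd a * b'"
    using cross dvd_triv_left by metis+
  then have "a = a'"
    using assms(3,4) by (simp add: coprime_dvd_mult_left_iff dvd_antisym)
  then show ?thesis
    using cross eqs ab by simp
qed

text \<open>A convex open set is the interior of its closure, so the cells agree. Joins through the
  point of one cell then pass through the other cell and hence through its point.\<close>

lemma closure_cell_inject:
  assumes "good a b s" "good a' b' s'" "coprime a b" "coprime a' b'"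
    and "closure (cell a b s) = closure (cell a' b' s')"
  shows "(a, b, s) = (a', b', s')"
proof -
  have "interior (closure (cell a b s)) = cell a b s" for a b s
    using convex_interior_closure[OF convex_cell] interior_open[OF open_cell] by simp
  then have "cell a b s = cell a' b' s'"
    using assms(5) by metis
  then have v: "vtx a b s \<in> cell a' b' s'"
    using vtx_in_cell[OF assms(1)] by simp
  have "lines a b s \<subseteq> lines a' b' s'"
  proof clarify
    fix i j assume L: "(i, j) \<in> lines a b s"
    then have "real (a + b) * offset i j (vtx a b s) = 0"
      using assms(1) unfolding offset_scaled by (simp add: vtx_def lines_def good_def)
    then have "offset i j (vtx a b s) = 0"
      using assms(1) by (simp add: good_def)
    then show "(i, j) \<in> lines a' b' s'"
      using side_through_cell[OF assms(2) v, of i j 0] L by (simp add: lines_def)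
  qed
  then show ?thesis
    using coprime_lines_determine assms by blast
qed

text \<open>Turns point-line incidences into complexity. Injectivity matters because complexity sums
  over a set, where coinciding faces would count once.\<close>

lemma ex_faces:
  assumes "finite V"
    and V: "\<And>a b s. (a, b, s) \<in> V \<Longrightarrow> good a b s \<and> coprime a b"
  shows "\<exists>\<F>. \<F> \<subseteq> faces arr \<and> finite \<F> \<and> card \<F> \<le> card V \<and>
    (\<Sum>(a, b, s)\<in>V. card (lines a b s)) \<le> complexity arr \<F>"
proof (intro exI conjI)
  let ?f = "\<lambda>(a, b, s). closure (cell a b s)"
  show "?f ` V \<subseteq> faces arr"
    using V cell_in_cells by (fastforce simp: faces_def)
  show "finite (?f ` V)" "card (?f ` V) \<le> card V"
    using assms(1) by (auto intro: card_image_le)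
  have "inj_on ?f V"
  proof (rule inj_onI)
    fix x y assume *: "x \<in> V" "y \<in> V" "?f x = ?f y"
    obtain a b s a' b' s' where xy: "x = (a, b, s)" "y = (a', b', s')"
      by (metis prod_cases3)
    show "x = y"
      using closure_cell_inject[of a b s a' b' s'] V[of a b s] V[of a' b' s'] * by (simp add: xy)
  qed
  then have "complexity arr (?f ` V) = (\<Sum>x\<in>V. face_complexity arr (?f x))"
    unfolding complexity_def by (simp add: sum.reindex)
  moreover have "(\<Sum>(a, b, s)\<in>V. card (lines a b s)) \<le> (\<Sum>x\<in>V. face_complexity arr (?f x))"
    using V card_lines_le_face_complexity by (intro sum_mono) auto
  ultimately show "(\<Sum>(a, b, s)\<in>V. card (lines a b s)) \<le> complexity arr (?f ` V)"
    by simp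
qed

section \<open>Counting incidences\<close>

text \<open>The values \<open>s\<close> partition the \<open>k^2\<close> pairs with
  \<open>i, j < k\<close> into at most \<open>2 * k * t\<close> classes. Dropping the classes of
  size below 2 loses at most \<open>2 * k * t\<close>, which is at most half of
  \<open>k^2\<close>.\<close>

lemma sum_card_lines_ge:
  assumes "1 \<le> a" "a \<le> t" "1 \<le> b" "b \<le> t" "4 * t \<le> k"
  shows "k ^ 2 \<le> 2 * (\<Sum>s\<in>{s. s < 2 * k * t \<and> 2 \<le> card (lines a b s)}. card (lines a b s))"
    (is "_ \<le> 2 * ?S")
proof -
  have "{..<k} \<times> {..<k} \<subseteq> (\<Union>s<2 * k * t. lines a b s)"
  proof (rule subrelI)
    fix i j assume ij: "(i, j) \<in> {..<k} \<times> {..<k}"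
    have "i * b + j * a \<le> i * t + j * t"
      using assms by (intro add_mono mult_left_mono) auto
    also have "\<dots> = (i + j) * t"
      by (simp add: algebra_simps)
    also have "\<dots> < (2 * k) * t"
      using ij assms by (intro mult_strict_right_mono) auto
    finally show "(i, j) \<in> (\<Union>s<2 * k * t. lines a b s)"
      using ij k_le_l by (simp add: lines_def)
  qed
  then have "card ({..<k} \<times> {..<k}) \<le> card (\<Union>s<2 * k * t. lines a b s)"
    by (rule card_mono[rotated]) (simp add: finite_lines)
  also have "\<dots> \<le> (\<Sum>s<2 * k * t. card (lines a b s))"
    by (rule card_UN_le) simp
  also have "\<dots> \<le> (\<Sum>s<2 * k * t. (if 2 \<le> card (lines a b s) then card (lines a b s) else 0) + 1)"
    by (intro sum_mono) auto
  also have "\<dots> = (\<Sum>s<2 * k * t. if 2 \<le> card (lines a b s) then card (lines a b s) else 0) + 2 * k * t"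
    by (simp only: sum.distrib) simp
  also have "(\<Sum>s<2 * k * t. if 2 \<le> card (lines a b s) then card (lines a b s) else 0) = ?S"
    by (simp add: sum.inter_filter[symmetric])
  finally have "k ^ 2 \<le> ?S + 2 * k * t"
    by (simp add: card_cartesian_product power2_eq_square)
  moreover have "k * (4 * t) \<le> k ^ 2"
    using assms(5) by (simp add: power2_eq_square)
  ultimately show ?thesis
    by linarith
qed

text \<open>At least \<open>t^2 / 4\<close> coprime directions, each with at least
  \<open>k^2 / 2\<close> incidences, give the factor 8; the number of triples is at most
  \<open>t^2\<close> times \<open>2 * k * t\<close>.\<close>

lemma ex_faces_many:
  assumes "1 \<le> t" "4 * t \<le> k"
  shows "\<exists>\<F>. \<F> \<subseteq> faces arr \<and> finite \<F> \<and> card \<F> \<le> 2 * k * t ^ 3 \<and>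
    t ^ 2 * k ^ 2 \<le> 8 * complexity arr \<F>"
proof -
  define P where "P = {(a, b) \<in> {1..t} \<times> {1..t}. coprime a b}"
  define S where "S = (\<lambda>(a, b). {s. s < 2 * k * t \<and> 2 \<le> card (lines a b s)})"
  define f :: "(nat \<times> nat) \<times> nat \<Rightarrow> nat \<times> nat \<times> nat" where "f = (\<lambda>((a, b), s). (a, b, s))"
  define V where "V = f ` Sigma P S"
  have P: "P \<subseteq> {1..t} \<times> {1..t}"
    by (auto simp: P_def)
  have finP: "finite P"
    using P by (rule finite_subset) simp
  have S: "S x \<subseteq> {..<2 * k * t}" for x
    by (cases x) (auto simp: S_def)
  have finS: "finite (S x)" for x
    using S[of x] by (rule finite_subset) simp
  have inj: "inj_on f (Sigma P S)"
    by (auto simp: inj_on_def f_def)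
  have "card V = card (Sigma P S)"
    unfolding V_def using inj by (rule card_image)
  also have "\<dots> \<le> card (({1..t} \<times> {1..t}) \<times> {..<2 * k * t})"
    using P S by (intro card_mono) auto
  also have "\<dots> = 2 * k * t ^ 3"
    by (simp add: card_cartesian_product power3_eq_cube)
  finally have card_V: "card V \<le> 2 * k * t ^ 3" .
  have "t ^ 2 * k ^ 2 \<le> 4 * card P * k ^ 2"
    unfolding P_def by (intro mult_right_mono card_coprime_pairs_ge) simp
  also have "\<dots> = 4 * (\<Sum>x\<in>P. k ^ 2)"
    by simp
  also have "\<dots> \<le> 4 * (\<Sum>x\<in>P. 2 * (\<Sum>s\<in>S x. card (lines (fst x) (snd x) s)))"
    using sum_card_lines_ge assms P
    by (intro mult_left_mono sum_mono) (auto simp: S_def)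
  also have "\<dots> = 8 * (\<Sum>(x, s)\<in>Sigma P S. card (lines (fst x) (snd x) s))"
    using finP finS by (simp add: sum.Sigma sum_distrib_left[symmetric])
  also have "(\<Sum>(x, s)\<in>Sigma P S. card (lines (fst x) (snd x) s)) = (\<Sum>(a, b, s)\<in>V. card (lines a b s))"
    unfolding V_def by (subst sum.reindex[OF inj]) (simp add: f_def case_prod_beta)
  finally have sum_V: "t ^ 2 * k ^ 2 \<le> 8 * (\<Sum>(a, b, s)\<in>V. card (lines a b s))" .
  have "finite V"
    unfolding V_def using finP finS by simp
  moreover have "good a b s \<and> coprime a b" if "(a, b, s) \<in> V" for a b s
  proof -
    have "(a, b) \<in> P" "s \<in> S (a, b)"
      using that by (auto simp: V_def f_def)
    moreover have "a + b \<le> n" if "a \<le> t" "b \<le> t"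
      using that assms k_le_l l_le_n by simp
    ultimately show ?thesis
      by (auto simp: P_def S_def good_def)
  qed
  ultimately obtain \<F> where "\<F> \<subseteq> faces arr" "finite \<F>" "card \<F> \<le> card V"
    "(\<Sum>(a, b, s)\<in>V. card (lines a b s)) \<le> complexity arr \<F>"
    using ex_faces[of V] by blast
  then show ?thesis
    using card_V sum_V by (intro exI[of _ \<F>]) auto
qed

text \<open>For few faces the richest points at height \<open>1 / 2\<close> suffice: those with
  \<open>s\<close> just below \<open>k\<close> lie on about \<open>k\<close> joins each.\<close>

lemma ex_faces_few:
  assumes "4 \<le> k" "M < 2 * k"
  shows "\<exists>\<F>. \<F> \<subseteq> faces arr \<and> finite \<F> \<and> card \<F> \<le> M \<and>
    M * k \<le> 12 * complexity arr \<F>"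
proof -
  \<comment> \<open>The cap keeps \<open>k - q\<close> at least \<open>k / 2\<close>;
    \<open>M < 2 * k\<close> and \<open>4 \<le> k\<close> give \<open>M \<le> 6 * q\<close> despite
    rounding.\<close>
  define q where "q = min M (k div 2)"
  define V where "V = (\<lambda>s. (1 :: nat, 1 :: nat, s)) ` {k - q..<k}"
  have q: "q \<le> M" "2 * q \<le> k" "M \<le> 6 * q"
    using assms by (auto simp: q_def)
  have inj: "inj_on (\<lambda>s. (1 :: nat, 1 :: nat, s)) {k - q..<k}"
    by (simp add: inj_on_def)
  have card_V: "card V = q"
    unfolding V_def card_image[OF inj] using q by simp
  have deg: "k - q < card (lines 1 1 s)" if "s \<in> {k - q..<k}" for s
  proof -
    \<comment> \<open>For \<open>s < k \<le> l\<close> no pair with sum \<open>s\<close> is cut off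
      by the index ranges.\<close>
    have "(\<lambda>i. (i, s - i)) ` {..s} \<subseteq> lines 1 1 s"
      using that k_le_l by (auto simp: lines_def)
    then have "card ((\<lambda>i. (i, s - i)) ` {..s}) \<le> card (lines 1 1 s)"
      using finite_lines by (intro card_mono)
    moreover have "inj_on (\<lambda>i. (i, s - i)) {..s}"
      by (simp add: inj_on_def)
    ultimately have "s + 1 \<le> card (lines 1 1 s)"
      by (simp add: card_image)
    then show ?thesis
      using that by simp
  qed
  have "finite V"
    by (simp add: V_def)
  moreover have "good a b s \<and> coprime a b" if "(a, b, s) \<in> V" for a b s
    using that deg[of s] q(2) assms(1) k_le_l l_le_n by (auto simp: V_def good_def)
  ultimately obtain \<F> where \<F>: "\<F> \<subseteq> faces arr" "finite \<F>" "card \<F> \<le> card V"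
    "(\<Sum>(a, b, s)\<in>V. card (lines a b s)) \<le> complexity arr \<F>"
    using ex_faces[of V] by blast
  have "M * k \<le> (6 * q) * (2 * (k - q))"
    using q by (intro mult_mono) auto
  also have "\<dots> = 12 * (\<Sum>s\<in>{k - q..<k}. k - q)"
    using q by simp
  also have "\<dots> \<le> 12 * (\<Sum>s\<in>{k - q..<k}. card (lines 1 1 s))"
    using deg by (intro mult_left_mono sum_mono) (auto intro: less_imp_le)
  also have "(\<Sum>s\<in>{k - q..<k}. card (lines 1 1 s)) = (\<Sum>(a, b, s)\<in>V. card (lines a b s))"
    unfolding V_def by (subst sum.reindex[OF inj]) simp
  finally have "M * k \<le> 12 * (\<Sum>(a, b, s)\<in>V. card (lines a b s))" .
  then show ?thesis
    using \<F> card_V q(1) by (intro exI[of _ \<F>]) auto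
qed

end

section \<open>Choice of parameters and comparison of exponents\<close>

theorem theorem5:
  "\<exists>(c::real) (n0::nat). c > 0 \<and>
     (\<forall>n\<ge>n0. \<exists>A. segment_arrangement A \<and> card (endpoints A) = n \<and>
        (\<forall>M::nat. 1 \<le> M \<and> M \<le> n ^ 4 \<longrightarrow>
           (\<exists>\<F>. \<F> \<subseteq> faces A \<and> finite \<F> \<and> card \<F> \<le> M \<and>
              real (complexity A \<F>)
                \<ge> c * min (real n * real M)
                         (real n powr (4/3) * real M powr (2/3)))))"
proof (intro exI[of _ "1 / 131072 :: real"] exI[of _ "12 :: nat"] conjI allI impI)
  fix n :: nat assume n: "12 \<le> n"
  \<comment> \<open>The \<open>2 * k\<close> bottom points and \<open>l\<close> top points add up to
    \<open>n\<close>; the bound \<open>12 \<le> n\<close> ensures \<open>4 \<le> k\<close> and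
    \<open>n \<le> 4 * k\<close>.\<close>
  define k where "k = n div 3"
  define l where "l = n - 2 * k"
  have k: "4 \<le> k" "n \<le> 4 * k" "k \<le> n" and kl: "2 * k + l = n" "k \<le> l" "l \<le> n"
    using n by (auto simp: k_def l_def)
  interpret double_fan n k l
    using k kl by unfold_locales auto
  have faces: "\<exists>\<F>. \<F> \<subseteq> faces arr \<and> finite \<F> \<and> card \<F> \<le> M \<and>
      1 / 131072 * min (real n * real M) (real n powr (4/3) * real M powr (2/3))
        \<le> real (complexity arr \<F>)"
    if M: "1 \<le> M" "M \<le> n ^ 4" for M
  proof (cases "M < 2 * k")
    case True
    then obtain \<F> where \<F>: "\<F> \<subseteq> faces arr" "finite \<F>" "card \<F> \<le> M" "M * k \<le> 12 * complexity arr \<F>"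
      using ex_faces_few k by blast
    have "n * M \<le> (4 * k) * M"
      using k by (intro mult_right_mono) auto
    also have "\<dots> = 4 * (M * k)"
      by simp
    finally have "n * M \<le> 48 * complexity arr \<F>"
      using \<F>(4) by linarith
    then have "real n * real M \<le> 48 * real (complexity arr \<F>)"
      using of_nat_mono by fastforce
    then have "1 / 131072 * min (real n * real M) (real n powr (4/3) * real M powr (2/3))
        \<le> real (complexity arr \<F>)"
      by linarith
    then show ?thesis
      using \<F> by blast
  next
    case False
    \<comment> \<open>The largest \<open>t\<close> for which \<open>ex_faces_many\<close> applies
      and stays within \<open>M\<close> faces; \<open>t = 1\<close> qualifies since
      \<open>2 * k \<le> M\<close>.\<close>
    define Q where "Q t \<longleftrightarrow> 4 * t \<le> k \<and> 2 * k * t ^ 3 \<le> M" for t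
    define t where "t = (GREATEST t. Q t)"
    have bnd: "\<And>t. Q t \<Longrightarrow> t \<le> k"
      by (simp add: Q_def)
    have "Q 1"
      using False k by (simp add: Q_def)
    then have t: "Q t" "1 \<le> t"
      unfolding t_def using GreatestI_nat[of Q 1 k] Greatest_le_nat[of Q 1 k] bnd by auto
    have "\<not> Q (t + 1)"
      using Greatest_le_nat[of Q "t + 1" k] bnd unfolding t_def[symmetric] by auto
    then have next_t: "k < 4 * (t + 1) \<or> M < 2 * k * (t + 1) ^ 3"
      by (auto simp: Q_def)
    obtain \<F> where \<F>: "\<F> \<subseteq> faces arr" "finite \<F>" "card \<F> \<le> 2 * k * t ^ 3"
      "t ^ 2 * k ^ 2 \<le> 8 * complexity arr \<F>"
      using ex_faces_many t by (auto simp: Q_def)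
    have "n ^ 2 \<le> (4 * k) ^ 2"
      using k by (intro power_mono) auto
    then have "t ^ 2 * n ^ 2 \<le> t ^ 2 * (4 * k) ^ 2"
      by (rule mult_left_mono) simp
    also have "\<dots> = 16 * (t ^ 2 * k ^ 2)"
      by (simp add: power_mult_distrib)
    finally have "t ^ 2 * n ^ 2 \<le> 128 * complexity arr \<F>"
      using \<F>(4) by linarith
    then have C: "real t ^ 2 * real n ^ 2 \<le> 128 * real (complexity arr \<F>)"
      using of_nat_mono[of "t ^ 2 * n ^ 2" "128 * complexity arr \<F>", where 'a = real] by simp
    have "real n powr (4/3) * real M powr (2/3) \<le> 1024 * (real t ^ 2 * real n ^ 2)"
      using next_t
    proof
      \<comment> \<open>Here \<open>t\<close> is linear in \<open>n\<close>, so
        \<open>t^2 * n^2\<close> has order \<open>n^4\<close>, and \<open>M \<le> n^4\<close> bounds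
        the target by \<open>n^4\<close>. The factor 1024 is \<open>32^2\<close>.\<close>
      assume "k < 4 * (t + 1)"
      moreover have "4 * (t + 1) \<le> 8 * t"
        using t(2) by simp
      ultimately have "k \<le> 8 * t"
        by linarith
      then have "n \<le> 32 * t"
        using k(2) by linarith
      then have "real n \<le> 32 * real t"
        by linarith
      then have n2: "real n ^ 2 \<le> (32 * real t) ^ 2"
        by (intro power_mono) auto
      have "real M \<le> real n ^ 4"
        using M of_nat_mono[of M "n ^ 4", where 'a = real] by simp
      then have "real M powr (2/3) \<le> (real n powr 4) powr (2/3)"
        using n by (intro powr_mono2) (auto simp: powr_realpow)
      also have "\<dots> = real n powr (8/3)"
        unfolding powr_powr by simp
      finally have "real n powr (4/3) * real M powr (2/3) \<le> real n powr (4/3) * real n powr (8/3)"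
        by (intro mult_left_mono) auto
      also have "\<dots> = real n powr 4"
        by (simp add: powr_add[symmetric])
      also have "\<dots> = real n ^ 2 * real n ^ 2"
        using n by (simp add: powr_realpow)
      also have "\<dots> \<le> (32 * real t) ^ 2 * real n ^ 2"
        using n2 by (intro mult_right_mono) auto
      finally show ?thesis
        by (simp add: power_mult_distrib)
    next
      \<comment> \<open>Here the number of faces is the limit: by \<open>t + 1 \<le> 2 * t\<close>,
        \<open>M\<close> is at most a constant times \<open>n * t^3\<close>, and raising this to the
        power \<open>2/3\<close> yields \<open>t^2\<close>.\<close>
      assume "M < 2 * k * (t + 1) ^ 3"
      also have "\<dots> \<le> 2 * n * (2 * t) ^ 3"
        using t k by (intro mult_mono power_mono) auto
      finally have "M \<le> 16 * (n * t ^ 3)"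
        by (simp add: power_mult_distrib)
      then have "real M \<le> 16 * (real n * real t ^ 3)"
        using of_nat_mono[of M "16 * (n * t ^ 3)", where 'a = real] by simp
      then have "real M powr (2/3) \<le> (16 * (real n * real t powr 3)) powr (2/3)"
        using t by (intro powr_mono2) (auto simp: powr_realpow)
      also have "\<dots> = 16 powr (2/3) * (real n powr (2/3) * real t powr 2)"
        unfolding powr_mult powr_powr by simp
      also have "\<dots> \<le> 16 powr 1 * (real n powr (2/3) * real t powr 2)"
        by (intro mult_right_mono powr_mono) auto
      finally have "real n powr (4/3) * real M powr (2/3)
          \<le> real n powr (4/3) * (16 * (real n powr (2/3) * real t powr 2))"
        by (intro mult_left_mono) auto
      also have "\<dots> = 16 * (real n powr (4/3 + 2/3) * real t powr 2)"
        unfolding powr_add by simp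
      also have "\<dots> = 16 * (real t ^ 2 * real n ^ 2)"
        using n t by (simp add: powr_realpow)
      also have "\<dots> \<le> 1024 * (real t ^ 2 * real n ^ 2)"
        by (intro mult_right_mono) auto
      finally show ?thesis .
    qed
    \<comment> \<open>The constant is \<open>128 * 1024\<close>, from \<open>C\<close> and the bound
      just shown.\<close>
    then have "1 / 131072 * min (real n * real M) (real n powr (4/3) * real M powr (2/3))
        \<le> real (complexity arr \<F>)"
      using C by linarith
    moreover have "card \<F> \<le> M"
      using \<F>(3) t(1) by (simp add: Q_def)
    ultimately show ?thesis
      using \<F> by blast
  qed
  show "\<exists>A. segment_arrangement A \<and> card (endpoints A) = n \<and>
        (\<forall>M::nat. 1 \<le> M \<and> M \<le> n ^ 4 \<longrightarrow>
           (\<exists>\<F>. \<F> \<subseteq> faces A \<and> finite \<F> \<and> card \<F> \<le> M \<and>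
              real (complexity A \<F>)
                \<ge> 1 / 131072 * min (real n * real M)
                         (real n powr (4/3) * real M powr (2/3))))"
    using segment_arrangement_arr card_endpoints_arr kl(1) faces by (intro exI[of _ arr]) auto
qed simp

end
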